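(* Let $k\ge 1$ be an integer and let $n,s$ be positive integers with $s^2\equiv 1 \pmod n$ and $s\not\equiv \pm 1 \pmod n$. Suppose that $n=n_1n_2$ where $n_1,n_2\ge 3$ are coprime integers with $s\equiv -1 \pmod{n_1}$ and $s\equiv 1\pmod{n_2}$. Then: (1) $$\mathsf D_{\{1,s\}}(C_n^k)\ \ge\ \mathsf D_{\{\pm1\}}(C_{n_1}^k)+\mathsf d(C_{n_2}^k)\ \ge\ k\left(\lfloor \log_2(n_1)\rfloor+n_2-1\right)+1;$$ (2) if $n_2$ is odd and either $n_1>n_2$ or $n_1$ is even, then $$\mathsf D_{\{1,s\}}(C_n^k)\ \ge\ k(2n_2-1)+1.$$
   Context: $C_m$ denotes the cyclic group of order $m$, written additively, and $C_m^k$ the direct sum of $k$ copies of it. A sequence over a finite abelian group $G$ is a finite unordered list of elements of $G$ with repetition allowed; its length is the number of terms counted with multiplicity. For a finite abelian group $G$ and a non-empty set $A\subset\mathbb Z$ containing no multiple of the exponent of $G$, the $A$-weighted Davenport constant $\mathsf D_A(G)$ is the smallest positive integer $D$ such that every sequence of length $D$ over $G$ has a non-empty subsequence $x_1,\dots,x_t$ with $\varepsilon_1x_1+\dots+\varepsilon_tx_t=0$ for some $\varepsilon_1,\dots,\varepsilon_t\in A$. The small Davenport constant $\mathsf d(G)$ is the maximal length of a sequence over $G$ having no non-empty subsequence whose terms sum to $0$. *)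

theory Defs
  imports
    Complex_Main
    "HOL-Algebra.FiniteProduct"
    "HOL-Algebra.Product_Groups"
    "HOL-Number_Theory.Cong"
    "HOL-Library.Multiset"
begin

text \<open>
  HOL-Algebra writes groups multiplicatively: for an additive group such as
  \<open>integer_mod_group m\<close>, the sum of a family is \<open>finprod\<close>, the multiple of \<open>x\<close> by an
  integer \<open>e\<close> is \<open>x [^] e\<close>, and zero is \<open>\<one>\<close>.
  For \<open>m > 0\<close>, \<open>integer_mod_group m\<close> has carrier \<open>{0..<int m}\<close> with addition modulo \<open>m\<close>.
\<close>

definition cyclic_power :: "nat \<Rightarrow> nat \<Rightarrow> (nat \<Rightarrow> int) monoid" where
  "cyclic_power m k = product_group {..<k} (\<lambda>_. integer_mod_group m)"

text \<open>
  A sequence over \<open>G\<close> (unordered, repetition allowed) is a multiset of elements of the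
  carrier. A subsequence \<open>x\<^sub>1,\<dots>,x\<^sub>t\<close> is enumerated by a list \<open>xs\<close>, so that
  each occurrence of a term receives its own weight.
\<close>

definition has_weighted_zero_subseq ::
    "('a, 'b) monoid_scheme \<Rightarrow> int set \<Rightarrow> 'a multiset \<Rightarrow> bool" where
  "has_weighted_zero_subseq G A S \<longleftrightarrow>
     (\<exists>xs es. xs \<noteq> [] \<and> mset xs \<subseteq># S \<and> length es = length xs \<and> set es \<subseteq> A \<and>
        finprod G (\<lambda>i. (xs ! i) [^]\<^bsub>G\<^esub> (es ! i)) {..<length xs} = \<one>\<^bsub>G\<^esub>)"

definition has_zero_subseq :: "('a, 'b) monoid_scheme \<Rightarrow> 'a multiset \<Rightarrow> bool" where
  "has_zero_subseq G S \<longleftrightarrow>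
     (\<exists>xs. xs \<noteq> [] \<and> mset xs \<subseteq># S \<and>
        finprod G (\<lambda>i. xs ! i) {..<length xs} = \<one>\<^bsub>G\<^esub>)"

text \<open>
  The two constants below are meaningful for a finite abelian group \<open>G\<close> and a non-empty
  \<open>A\<close> containing no multiple of the exponent of \<open>G\<close>; then the minimum and the maximum exist.
\<close>

definition weighted_davenport :: "int set \<Rightarrow> ('a, 'b) monoid_scheme \<Rightarrow> nat" where
  "weighted_davenport A G =
     (LEAST D. D > 0 \<and>
        (\<forall>S. set_mset S \<subseteq> carrier G \<and> size S = D \<longrightarrow> has_weighted_zero_subseq G A S))"

definition small_davenport :: "('a, 'b) monoid_scheme \<Rightarrow> nat" where
  "small_davenport G =
     (GREATEST l. \<exists>S. set_mset S \<subseteq> carrier G \<and> size S = l \<and> \<not> has_zero_subseq G S)"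

end

theory Submission
  imports Defs
begin

text \<open>
  By the Chinese remainder theorem \<open>C\<^sub>n\<^sup>k\<close> is the direct sum of \<open>C\<^bsub>n1\<^esub>\<^sup>k\<close> and
  \<open>C\<^bsub>n2\<^esub>\<^sup>k\<close>, and \<open>s\<close> acts as \<open>-1\<close> on the first summand and as \<open>1\<close> on the second. The weights
  \<open>{1, s}\<close> therefore amount to \<open>{1, -1}\<close> on the first summand and to plain sums on the second. Take
  a longest sequence in each summand that has no zero subsum for these weights. Their union, inside
  the direct sum, has none for \<open>{1, s}\<close>, because the two components of a zero sum vanish separately
  (\<open>weighted_zero_free_coprime_Plus\<close>). This gives the first inequality.

  The explicit bounds come from long zero-sum free sequences in rank one. Placing a copy of such a
  sequence on each of the \<open>k\<close> coordinates multiplies its length by \<open>k\<close>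
  (\<open>weighted_davenport_ge_copies\<close>). The three sequences are

  \<^item> \<open>1, 2, 4, \<dots>\<close> up to \<open>n1 / 2\<close>, for the weights \<open>\<plusminus>1\<close>: a signed sum of distinct powers of two is
    a non-zero integer, and here it is smaller than \<open>n1\<close> in absolute value;
  \<^item> \<open>n2 - 1\<close> ones, for plain sums modulo \<open>n2\<close>;
  \<^item> \<open>2 * n2 - 1\<close> ones in \<open>C\<^sub>n\<close>, for the weights \<open>{1, s}\<close>: vanishing modulo \<open>n2\<close> forces exactly
    \<open>n2\<close> terms, an odd number, and a sum of \<open>n2\<close> signs is odd and at most \<open>n2\<close> in absolute value, so
    it cannot vanish modulo \<open>n1\<close> when \<open>n1\<close> is even or exceeds \<open>n2\<close>.

  All this is arithmetic with integers. To separate it from multisets and abstract groups, a sequence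
  is handled as a family of integer vectors indexed by a finite set, and a zero sum as a divisibility
  in each coordinate (\<open>weighted_zero_free\<close>). The constants of the theorem are then read off from
  such families: one without zero sums has fewer members than the weighted Davenport constant
  (\<open>weighted_davenport_greater\<close>), and one with just one member fewer exists
  (\<open>weighted_davenport_extremal\<close>).
\<close>

section \<open>Zero sums in coordinates\<close>

text \<open>
  The entries are arbitrary integers rather than reduced residues, so that sequences can be scaled
  and reweighted without normalising them.
\<close>

definition weighted_zero_free ::
    "nat \<Rightarrow> nat \<Rightarrow> int set \<Rightarrow> 'i set \<Rightarrow> ('i \<Rightarrow> nat \<Rightarrow> int) \<Rightarrow> bool" where
  "weighted_zero_free m k A I f \<longleftrightarrow>
     (\<forall>J e. J \<subseteq> I \<longrightarrow> J \<noteq> {} \<longrightarrow> e \<in> J \<rightarrow> A \<longrightarrow> (\<exists>j<k. \<not> int m dvd (\<Sum>i\<in>J. e i * f i j)))"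

lemma weighted_zero_freeD:
  assumes "weighted_zero_free m k A I f" "J \<subseteq> I" "J \<noteq> {}" "e \<in> J \<rightarrow> A"
  obtains j where "j < k" "\<not> int m dvd (\<Sum>i\<in>J. e i * f i j)"
  using assms unfolding weighted_zero_free_def by blast

lemma weighted_zero_free_rank_oneI:
  assumes "\<And>J e. J \<subseteq> I \<Longrightarrow> J \<noteq> {} \<Longrightarrow> e \<in> J \<rightarrow> A \<Longrightarrow> \<not> int m dvd (\<Sum>i\<in>J. e i * g i)"
  shows "weighted_zero_free m 1 A I (\<lambda>i _. g i)"
  unfolding weighted_zero_free_def using assms zero_less_one by blast

lemma weighted_zero_free_mono:
  "weighted_zero_free m k A I f \<Longrightarrow> I' \<subseteq> I \<Longrightarrow> weighted_zero_free m k A I' f"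
  unfolding weighted_zero_free_def by (meson order_trans)

lemma cyclic_power_comm_group: "comm_group (cyclic_power m k)"
proof -
  interpret group "cyclic_power m k"
    unfolding cyclic_power_def by simp
  show ?thesis
    by unfold_locales (auto simp: cyclic_power_def add.commute)
qed

lemma carrier_cyclic_power:
  "m > 0 \<Longrightarrow> carrier (cyclic_power m k) = {..<k} \<rightarrow>\<^sub>E {0..<int m}"
  by (simp add: cyclic_power_def carrier_integer_mod_group)

lemma coordinate_hom:
  assumes "j < k"
  shows "(\<lambda>x. x j) \<in> hom (cyclic_power m k) (integer_mod_group m)"
  using assms by (auto simp: hom_def cyclic_power_def)

text \<open>
  The projection to a coordinate is a homomorphism, so it carries multiples to multiples.
\<close>

lemma coordinate_int_pow:
  assumes "x \<in> carrier (cyclic_power m k)" "j < k"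
  shows "(x [^]\<^bsub>cyclic_power m k\<^esub> (e::int)) j = (e * x j) mod int m"
proof -
  interpret group_hom "cyclic_power m k" "integer_mod_group m" "\<lambda>x. x j"
    using cyclic_power_comm_group coordinate_hom[OF assms(2)]
    by (simp add: group_hom_def group_hom_axioms_def comm_group_def)
  show ?thesis
    using hom_int_pow[OF assms(1)] by (simp add: int_pow_integer_mod_group)
qed

lemma coordinate_finprod:
  assumes "finite I" "g \<in> I \<rightarrow> carrier (cyclic_power m k)" "j < k"
  shows "finprod (cyclic_power m k) g I j = (\<Sum>i\<in>I. g i j) mod int m"
proof -
  interpret comm_group "cyclic_power m k"
    by (rule cyclic_power_comm_group)
  show ?thesis
    using assms(1,2)
  proof (induction I)
    case empty
    have "\<one>\<^bsub>cyclic_power m k\<^esub> j = 0"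
      using assms(3) by (simp add: cyclic_power_def)
    then show ?case by simp
  next
    case (insert i I)
    have "finprod (cyclic_power m k) g (insert i I)
        = g i \<otimes>\<^bsub>cyclic_power m k\<^esub> finprod (cyclic_power m k) g I"
      using insert by (intro finprod_insert) auto
    with insert assms(3) show ?case
      by (auto simp: cyclic_power_def mod_simps)
  qed
qed

lemma weighted_finprod_eq_one_iff:
  assumes "m > 0" "finite I" "x \<in> I \<rightarrow> carrier (cyclic_power m k)"
  shows "finprod (cyclic_power m k) (\<lambda>i. x i [^]\<^bsub>cyclic_power m k\<^esub> (e i :: int)) I
           = \<one>\<^bsub>cyclic_power m k\<^esub>
         \<longleftrightarrow> (\<forall>j<k. int m dvd (\<Sum>i\<in>I. e i * x i j))"
proof -
  interpret comm_group "cyclic_power m k"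
    by (rule cyclic_power_comm_group)
  let ?g = "\<lambda>i. x i [^]\<^bsub>cyclic_power m k\<^esub> e i"
  let ?p = "finprod (cyclic_power m k) ?g I"
  have g: "?g \<in> I \<rightarrow> carrier (cyclic_power m k)"
    using assms(3) by auto
  have "?p \<in> {..<k} \<rightarrow>\<^sub>E {0..<int m}"
    using finprod_closed[OF g] carrier_cyclic_power[OF assms(1)] by blast
  moreover have "\<one>\<^bsub>cyclic_power m k\<^esub> = (\<lambda>j\<in>{..<k}. 0)"
    by (simp add: cyclic_power_def)
  ultimately have "?p = \<one>\<^bsub>cyclic_power m k\<^esub> \<longleftrightarrow> (\<forall>j<k. ?p j = 0)"
    by (auto simp: fun_eq_iff PiE_iff extensional_def)
  also have "\<dots> \<longleftrightarrow> (\<forall>j<k. int m dvd (\<Sum>i\<in>I. e i * x i j))"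
  proof (intro all_cong1 imp_cong refl)
    fix j assume "j < k"
    have "?p j = (\<Sum>i\<in>I. ?g i j) mod int m"
      by (rule coordinate_finprod[OF assms(2) g \<open>j < k\<close>])
    also have "(\<Sum>i\<in>I. ?g i j) = (\<Sum>i\<in>I. (e i * x i j) mod int m)"
      using assms(3) \<open>j < k\<close> by (intro sum.cong refl coordinate_int_pow) auto
    also have "\<dots> mod int m = (\<Sum>i\<in>I. e i * x i j) mod int m"
      by (rule mod_sum_eq)
    finally show "?p j = 0 \<longleftrightarrow> int m dvd (\<Sum>i\<in>I. e i * x i j)"
      by (simp add: dvd_eq_mod_eq_0)
  qed
  finally show ?thesis .
qed

text \<open>
  Choosing a preimage for each term turns a subsequence of a family into a list of indices.
\<close>

lemma mset_subseteq_image_msetE: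
  assumes "mset xs \<subseteq># image_mset f M"
  obtains ys where "mset ys \<subseteq># M" "map f ys = xs"
proof -
  have "\<exists>ys. mset ys \<subseteq># M \<and> map f ys = xs"
    using assms
  proof (induction xs arbitrary: M)
    case (Cons x xs)
    from Cons.prems have "x \<in># image_mset f M"
      by (simp add: insert_subset_eq_iff)
    then obtain y where y: "y \<in># M" "f y = x" by auto
    with Cons.prems have "mset xs \<subseteq># image_mset f (M - {#y#})"
      by (simp add: insert_subset_eq_iff image_mset_Diff)
    with Cons.IH obtain ys where "mset ys \<subseteq># M - {#y#}" "map f ys = xs" by blast
    with y show ?case
      by (intro exI[of _ "y # ys"]) (simp add: insert_subset_eq_iff)
  qed auto
  with that show ?thesis by blast
qed

text \<open>
  In \<open>mset_set I\<close> every index occurs once. Subsequences of the multiset of terms are thus given by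
  duplicate-free lists of indices, and these correspond to subsets \<open>J\<close> of \<open>I\<close>.
\<close>

lemma has_weighted_zero_subseq_iff:
  assumes "m > 0" "finite I" "f \<in> I \<rightarrow> carrier (cyclic_power m k)"
  shows "has_weighted_zero_subseq (cyclic_power m k) A (image_mset f (mset_set I))
         \<longleftrightarrow> \<not> weighted_zero_free m k A I f"
proof
  assume "has_weighted_zero_subseq (cyclic_power m k) A (image_mset f (mset_set I))"
  then obtain xs es where xs: "xs \<noteq> []" "mset xs \<subseteq># image_mset f (mset_set I)"
    and es: "length es = length xs" "set es \<subseteq> A"
    and zero: "finprod (cyclic_power m k) (\<lambda>i. (xs ! i) [^]\<^bsub>cyclic_power m k\<^esub> (es ! i)) {..<length xs}
      = \<one>\<^bsub>cyclic_power m k\<^esub>"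
    unfolding has_weighted_zero_subseq_def by blast
  from xs(2) obtain ys where ys: "mset ys \<subseteq># mset_set I" "map f ys = xs"
    by (rule mset_subseteq_image_msetE)
  have sub: "set ys \<subseteq> I"
    using set_mset_mono[OF ys(1)] assms(2) by simp
  have "distinct ys"
    unfolding distinct_count_atmost_1
  proof
    fix a
    have "count (mset ys) a \<le> count (mset_set I) a"
      using ys(1) by (rule mset_subset_eq_count)
    then show "count (mset ys) a = (if a \<in> set ys then 1 else 0)"
      using assms(2) sub
      by (cases "a \<in> set ys") (auto simp: count_mset_set' Suc_le_eq le_antisym split: if_splits)
  qed
  define n where "n = length ys"
  have bij: "bij_betw ((!) ys) {..<n} (set ys)"
    using \<open>distinct ys\<close> by (intro bij_betw_nth) (auto simp: n_def)
  have len: "length xs = n" "length es = n" and nth: "\<And>i. i < n \<Longrightarrow> xs ! i = f (ys ! i)"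
    using ys(2) es(1) by (auto simp: n_def)
  have xc: "(!) xs \<in> {..<n} \<rightarrow> carrier (cyclic_power m k)"
    using nth assms(3) sub by (fastforce simp: n_def dest: nth_mem)
  define e where "e y = es ! inv_into {..<n} ((!) ys) y" for y
  have e_nth: "e (ys ! i) = es ! i" if "i < n" for i
    using bij that by (simp add: e_def bij_betw_inv_into_left)
  have "e y \<in> A" if "y \<in> set ys" for y
  proof -
    from bij that obtain i where "i < n" "y = ys ! i"
      by (auto simp: bij_betw_def)
    with e_nth es len show ?thesis by auto
  qed
  moreover have "int m dvd (\<Sum>y\<in>set ys. e y * f y j)" if "j < k" for j
  proof -
    have "(\<Sum>y\<in>set ys. e y * f y j) = (\<Sum>i<n. e (ys ! i) * f (ys ! i) j)"
      by (rule sum.reindex_bij_betw[OF bij, symmetric])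
    also have "\<dots> = (\<Sum>i<n. es ! i * (xs ! i) j)"
      by (simp add: e_nth nth)
    finally show ?thesis
      using zero weighted_finprod_eq_one_iff[OF assms(1) _ xc, of "(!) es"] that len by simp
  qed
  moreover have "set ys \<noteq> {}" using xs(1) ys(2) by auto
  ultimately show "\<not> weighted_zero_free m k A I f"
    using sub unfolding weighted_zero_free_def by blast
next
  assume "\<not> weighted_zero_free m k A I f"
  then obtain J e where J: "J \<subseteq> I" "J \<noteq> {}" "e \<in> J \<rightarrow> A"
    and zero: "\<And>j. j < k \<Longrightarrow> int m dvd (\<Sum>i\<in>J. e i * f i j)"
    unfolding weighted_zero_free_def by blast
  have "finite J" using J(1) assms(2) by (rule finite_subset)
  then obtain ys where ys: "set ys = J" "distinct ys"
    using finite_distinct_list by blast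
  define n where "n = length ys"
  have bij: "bij_betw ((!) ys) {..<n} J"
    using ys by (intro bij_betw_nth) (auto simp: n_def)
  have xc: "(\<lambda>i. map f ys ! i) \<in> {..<n} \<rightarrow> carrier (cyclic_power m k)"
    using ys J(1) assms(3) by (fastforce simp: n_def dest: nth_mem)
  have "int m dvd (\<Sum>i<n. map e ys ! i * (map f ys ! i) j)" if "j < k" for j
  proof -
    have "(\<Sum>i<n. map e ys ! i * (map f ys ! i) j) = (\<Sum>i<n. e (ys ! i) * f (ys ! i) j)"
      by (simp add: n_def)
    also have "\<dots> = (\<Sum>y\<in>J. e y * f y j)"
      by (rule sum.reindex_bij_betw[OF bij])
    finally show ?thesis using zero[OF that] by simp
  qed
  then have "finprod (cyclic_power m k)
      (\<lambda>i. (map f ys ! i) [^]\<^bsub>cyclic_power m k\<^esub> (map e ys ! i)) {..<n} = \<one>\<^bsub>cyclic_power m k\<^esub>"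
    using weighted_finprod_eq_one_iff[OF assms(1) _ xc, of "\<lambda>i. map e ys ! i"] by simp
  moreover have "mset (map f ys) \<subseteq># image_mset f (mset_set I)"
    using ys J(1) assms(2)
    by (auto simp flip: mset_set_set intro!: image_mset_subseteq_mono subset_imp_msubset_mset_set)
  moreover have "ys \<noteq> []" "set (map e ys) \<subseteq> A"
    using J ys by auto
  ultimately show "has_weighted_zero_subseq (cyclic_power m k) A (image_mset f (mset_set I))"
    unfolding has_weighted_zero_subseq_def n_def
    by (intro exI[of _ "map f ys"] exI[of _ "map e ys"]) simp
qed

lemma multiset_as_family:
  obtains f where "S = image_mset f (mset_set {..<size S})" "f \<in> {..<size S} \<rightarrow> set_mset S"
proof -
  obtain xs where xs: "mset xs = S" using ex_mset by blast
  have "S = mset (map ((!) xs) [0..<length xs])"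
    using xs by (simp only: map_nth)
  also have "\<dots> = image_mset ((!) xs) (mset_set {..<size S})"
    using xs by (auto simp: atLeast0LessThan simp del: map_nth)
  finally show ?thesis
    using xs by (intro that) auto
qed

section \<open>The Davenport constants through zero-sum free families\<close>

text \<open>
  Two of the \<open>N + 1\<close> initial sums coincide modulo \<open>m\<close> as soon as \<open>N\<close> reaches the order \<open>m ^ k\<close> of the
  group. Their difference is a vanishing block sum, and giving every term of the block the same weight
  keeps it zero.
\<close>

lemma weighted_zero_free_card_less:
  assumes "m > 0" "A \<noteq> {}" "weighted_zero_free m k A {..<N} f"
  shows "N < m ^ k"
proof (rule ccontr)
  assume "\<not> N < m ^ k"
  define p where "p t = (\<lambda>j\<in>{..<k}. (\<Sum>i<t. f i j) mod int m)" for t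
  let ?P = "{..<k} \<rightarrow>\<^sub>E {0..<int m}"
  have "finite ?P" "card ?P = m ^ k"
    by (auto simp: card_PiE finite_PiE)
  moreover have "p ` {..N} \<subseteq> ?P"
    using assms(1) by (auto simp: p_def PiE_iff extensional_def split: if_splits)
  ultimately have "\<not> inj_on p {..N}"
    using card_inj_on_le[of p "{..N}" ?P] \<open>\<not> N < m ^ k\<close> by auto
  then obtain t t' where t: "t < t'" "t' \<le> N" "p t = p t'"
    unfolding inj_on_def by (metis atMost_iff linorder_neqE_nat)
  from assms(2) obtain a where "a \<in> A" by blast
  have "int m dvd (\<Sum>i\<in>{t..<t'}. a * f i j)" if "j < k" for j
  proof -
    have "(\<Sum>i<t. f i j) + (\<Sum>i\<in>{t..<t'}. f i j) = (\<Sum>i<t'. f i j)"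
      using t(1) sum.atLeastLessThan_concat[of 0 t t' "\<lambda>i. f i j"] by (simp add: atLeast0LessThan)
    moreover have "(\<Sum>i<t. f i j) mod int m = (\<Sum>i<t'. f i j) mod int m"
      using fun_cong[OF t(3), of j] that by (simp add: p_def)
    ultimately have "int m dvd (\<Sum>i\<in>{t..<t'}. f i j)"
      by (metis add_diff_cancel_left' mod_eq_dvd_iff)
    then show ?thesis
      by (simp flip: sum_distrib_left)
  qed
  moreover have "{t..<t'} \<subseteq> {..<N}" "{t..<t'} \<noteq> {}" "(\<lambda>_. a) \<in> {t..<t'} \<rightarrow> A"
    using t(1,2) \<open>a \<in> A\<close> by auto
  then obtain j where "j < k" "\<not> int m dvd (\<Sum>i\<in>{t..<t'}. a * f i j)"
    by (rule weighted_zero_freeD[OF assms(3)])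
  ultimately show False by blast
qed

text \<open>
  This lemma and the next pass between families and multisets over the carrier. Here the entries have
  to be reduced modulo \<open>m\<close> first.
\<close>

lemma weighted_zero_free_multiset:
  assumes "m > 0" "finite I" "weighted_zero_free m k A I f"
  obtains S where "set_mset S \<subseteq> carrier (cyclic_power m k)" "size S = card I"
    "\<not> has_weighted_zero_subseq (cyclic_power m k) A S"
proof -
  define g where "g i = (\<lambda>j\<in>{..<k}. f i j mod int m)" for i
  have g: "g \<in> I \<rightarrow> carrier (cyclic_power m k)"
    using assms(1) by (auto simp: g_def carrier_cyclic_power PiE_iff)
  have "int m dvd (\<Sum>i\<in>J. e i * g i j) \<longleftrightarrow> int m dvd (\<Sum>i\<in>J. e i * f i j)" if "j < k" for J e j
  proof -
    have "(\<Sum>i\<in>J. e i * g i j) mod int m = (\<Sum>i\<in>J. (e i * f i j) mod int m) mod int m"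
      using that by (subst mod_sum_eq[symmetric]) (simp add: g_def mod_simps)
    then show ?thesis by (simp add: mod_sum_eq dvd_eq_mod_eq_0)
  qed
  with assms(3) have "weighted_zero_free m k A I g"
    unfolding weighted_zero_free_def by blast
  with has_weighted_zero_subseq_iff[OF assms(1,2) g] g assms(2) show ?thesis
    by (intro that[of "image_mset g (mset_set I)"]) auto
qed

lemma multiset_weighted_zero_free:
  assumes "m > 0" "set_mset S \<subseteq> carrier (cyclic_power m k)"
    "\<not> has_weighted_zero_subseq (cyclic_power m k) A S"
  obtains f where "weighted_zero_free m k A {..<size S} f"
proof -
  obtain f where f: "S = image_mset f (mset_set {..<size S})" "f \<in> {..<size S} \<rightarrow> set_mset S"
    by (rule multiset_as_family)
  with assms(2) have "f \<in> {..<size S} \<rightarrow> carrier (cyclic_power m k)" by auto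
  with has_weighted_zero_subseq_iff[OF assms(1) finite_lessThan this, of A] f(1) assms(3) that
  show ?thesis by metis
qed

text \<open>
  The minimum in the definition of the weighted Davenport constant is attained, because the length
  \<open>m ^ k\<close> already forces a weighted zero sum.
\<close>

lemma weighted_davenport_forces_zero_subseq:
  assumes "m > 0" "A \<noteq> {}"
  shows "weighted_davenport A (cyclic_power m k) > 0 \<and>
    (\<forall>S. set_mset S \<subseteq> carrier (cyclic_power m k) \<and> size S = weighted_davenport A (cyclic_power m k)
      \<longrightarrow> has_weighted_zero_subseq (cyclic_power m k) A S)"
  unfolding weighted_davenport_def
proof (rule LeastI, intro conjI allI impI)
  show "m ^ k > 0" using assms(1) by simp
next
  fix S assume S: "set_mset S \<subseteq> carrier (cyclic_power m k) \<and> size S = m ^ k"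
  show "has_weighted_zero_subseq (cyclic_power m k) A S"
  proof (rule ccontr)
    assume "\<not> ?thesis"
    with S obtain f where "weighted_zero_free m k A {..<m ^ k} f"
      using multiset_weighted_zero_free[OF assms(1), of S] by auto
    from weighted_zero_free_card_less[OF assms this] show False by simp
  qed
qed

text \<open>
  Zero-sum freeness passes to subsets of the index set. If \<open>I\<close> had at least as many elements as the
  constant, a subset of exactly that size would contradict the defining property.
\<close>

lemma weighted_davenport_greater:
  assumes "m > 0" "A \<noteq> {}" "finite I" "weighted_zero_free m k A I f"
  shows "weighted_davenport A (cyclic_power m k) > card I"
proof (rule ccontr)
  assume "\<not> ?thesis"
  then obtain I' where I': "I' \<subseteq> I" "card I' = weighted_davenport A (cyclic_power m k)"
    using obtain_subset_with_card_n by (metis not_less)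
  with assms(3) have "finite I'" by (blast intro: finite_subset)
  obtain S where "set_mset S \<subseteq> carrier (cyclic_power m k)" "size S = card I'"
    "\<not> has_weighted_zero_subseq (cyclic_power m k) A S"
    by (rule weighted_zero_free_multiset[OF assms(1) \<open>finite I'\<close>
          weighted_zero_free_mono[OF assms(4) I'(1)]])
  with weighted_davenport_forces_zero_subseq[OF assms(1,2), of k] I'(2) show False by simp
qed

lemma weighted_davenport_extremal:
  assumes "m > 0" "A \<noteq> {}"
  obtains f where "weighted_zero_free m k A {..<weighted_davenport A (cyclic_power m k) - 1} f"
proof (cases "weighted_davenport A (cyclic_power m k) = 1")
  \<comment> \<open>The definition only admits positive lengths, so minimality says nothing about length 0. The empty
    family serves here.\<close>
  case True
  then show ?thesis
    using that by (simp add: weighted_zero_free_def)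
next
  case False
  let ?D = "weighted_davenport A (cyclic_power m k)"
  have D: "?D - 1 > 0" "?D - 1 < ?D"
    using False weighted_davenport_forces_zero_subseq[OF assms, of k] by auto
  have "\<not> (\<forall>S. set_mset S \<subseteq> carrier (cyclic_power m k) \<and> size S = ?D - 1
          \<longrightarrow> has_weighted_zero_subseq (cyclic_power m k) A S)"
    using not_less_Least[OF D(2)[unfolded weighted_davenport_def]] D(1)
    unfolding weighted_davenport_def by blast
  then obtain S where "set_mset S \<subseteq> carrier (cyclic_power m k)" "size S = ?D - 1"
    "\<not> has_weighted_zero_subseq (cyclic_power m k) A S" by blast
  with multiset_weighted_zero_free[OF assms(1), of S] that show ?thesis by auto
qed

lemma has_zero_subseq_iff_weighted:
  assumes "set_mset S \<subseteq> carrier (cyclic_power m k)"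
  shows "has_zero_subseq (cyclic_power m k) S
         \<longleftrightarrow> has_weighted_zero_subseq (cyclic_power m k) {1} S"
proof -
  interpret comm_group "cyclic_power m k"
    by (rule cyclic_power_comm_group)
  have "finprod (cyclic_power m k) (\<lambda>i. (xs ! i) [^]\<^bsub>cyclic_power m k\<^esub> (es ! i)) {..<length xs}
      = finprod (cyclic_power m k) (\<lambda>i. xs ! i) {..<length xs}"
    if "mset xs \<subseteq># S" "length es = length xs" "set es \<subseteq> {1::int}"
    for xs and es :: "int list"
  proof (rule finprod_cong')
    have carrier: "xs ! i \<in> carrier (cyclic_power m k)" if "i < length xs" for i
      using set_mset_mono[OF \<open>mset xs \<subseteq># S\<close>] assms that by (auto dest: nth_mem)
    then show "(\<lambda>i. xs ! i) \<in> {..<length xs} \<rightarrow> carrier (cyclic_power m k)"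
      by auto
    fix i assume i: "i \<in> {..<length xs}"
    with that(2,3) have "es ! i = 1"
      by (metis lessThan_iff nth_mem singletonD subsetD)
    with i carrier show "(xs ! i) [^]\<^bsub>cyclic_power m k\<^esub> (es ! i) = xs ! i" by simp
  qed simp
  note unweighted = this
  show ?thesis
  proof
    assume "has_zero_subseq (cyclic_power m k) S"
    then obtain xs where "xs \<noteq> []" "mset xs \<subseteq># S"
      "finprod (cyclic_power m k) (\<lambda>i. xs ! i) {..<length xs} = \<one>\<^bsub>cyclic_power m k\<^esub>"
      unfolding has_zero_subseq_def by blast
    with unweighted[of xs "replicate (length xs) 1"]
    show "has_weighted_zero_subseq (cyclic_power m k) {1} S"
      unfolding has_weighted_zero_subseq_def
      by (intro exI[of _ xs] exI[of _ "replicate (length xs) 1"]) auto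
  next
    assume "has_weighted_zero_subseq (cyclic_power m k) {1} S"
    then show "has_zero_subseq (cyclic_power m k) S"
      unfolding has_zero_subseq_def has_weighted_zero_subseq_def using unweighted by force
  qed
qed

text \<open>
  A sequence has no zero subsum exactly if it has no \<open>{1}\<close>-weighted one, so the greatest length of a
  zero-sum free sequence is one less than the least length that forces a zero sum.
\<close>

lemma Suc_small_davenport_cyclic_power:
  assumes "m > 0"
  shows "Suc (small_davenport (cyclic_power m k)) = weighted_davenport {1} (cyclic_power m k)"
proof -
  let ?D = "weighted_davenport {1} (cyclic_power m k)"
  let ?free = "\<lambda>l S. set_mset S \<subseteq> carrier (cyclic_power m k) \<and> size S = l
    \<and> \<not> has_zero_subseq (cyclic_power m k) S"
  have D: "?D > 0"
    using weighted_davenport_forces_zero_subseq[OF assms] by simp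
  have "(GREATEST l. \<exists>S. ?free l S) = ?D - 1"
  proof (rule Greatest_equality)
    obtain f where "weighted_zero_free m k {1} {..<?D - 1} f"
      using weighted_davenport_extremal[OF assms, of "{1}"] by auto
    from weighted_zero_free_multiset[OF assms finite_lessThan this]
    obtain S where "set_mset S \<subseteq> carrier (cyclic_power m k)" "size S = ?D - 1"
      "\<not> has_weighted_zero_subseq (cyclic_power m k) {1} S"
      by (metis card_lessThan)
    then show "\<exists>S. ?free (?D - 1) S"
      using has_zero_subseq_iff_weighted by blast
  next
    fix l assume "\<exists>S. ?free l S"
    then obtain S where "set_mset S \<subseteq> carrier (cyclic_power m k)" "size S = l"
      "\<not> has_weighted_zero_subseq (cyclic_power m k) {1} S"
      using has_zero_subseq_iff_weighted by blast
    with multiset_weighted_zero_free[OF assms, of S] obtain f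
      where "weighted_zero_free m k {1} {..<l} f" by auto
    from weighted_davenport_greater[OF assms _ _ this] show "l \<le> ?D - 1" by simp
  qed
  with D show ?thesis by (simp add: small_davenport_def)
qed

section \<open>Combining zero-sum free families\<close>

text \<open>
  Multiplication by \<open>m2\<close> embeds \<open>C\<^bsub>m1\<^esub>\<close> into \<open>C\<^bsub>m1 * m2\<^esub>\<close> as the elements that vanish modulo \<open>m2\<close>, and
  symmetrically for \<open>m1\<close>. A sum over the combined family, read modulo \<open>m1\<close>, is \<open>m2\<close> times the sum of
  its first part, where \<open>m2\<close> is invertible. So if it vanishes modulo \<open>m1 * m2\<close>, each part vanishes for
  its own modulus, and in each part the weights matter only modulo that modulus. This is why a weight
  in \<open>A\<close> needs to agree with one in \<open>A1\<close> modulo \<open>m1\<close> and with one in \<open>A2\<close> modulo \<open>m2\<close> only.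
\<close>

lemma weighted_zero_free_coprime_Plus:
  assumes "coprime m1 m2"
    and free1: "weighted_zero_free m1 k A1 I1 f1" and free2: "weighted_zero_free m2 k A2 I2 f2"
    and "finite I1" "finite I2"
    and A1: "\<And>a. a \<in> A \<Longrightarrow> \<exists>b\<in>A1. [a = b] (mod int m1)"
    and A2: "\<And>a. a \<in> A \<Longrightarrow> \<exists>b\<in>A2. [a = b] (mod int m2)"
  shows "weighted_zero_free (m1 * m2) k A (I1 <+> I2)
    (case_sum (\<lambda>i j. int m2 * f1 i j) (\<lambda>i j. int m1 * f2 i j))" (is "weighted_zero_free _ _ _ _ ?f")
  unfolding weighted_zero_free_def
proof (intro allI impI)
  fix J e assume J: "J \<subseteq> I1 <+> I2" "J \<noteq> {}" and e: "e \<in> J \<rightarrow> A"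
  define J1 J2 where "J1 = Inl -` J" and "J2 = Inr -` J"
  have J_eq: "J = J1 <+> J2"
  proof (rule Set.set_eqI)
    show "x \<in> J \<longleftrightarrow> x \<in> J1 <+> J2" for x
      by (cases x) (auto simp: J1_def J2_def)
  qed
  have sub: "J1 \<subseteq> I1" "J2 \<subseteq> I2"
    using J(1) by (auto simp: J1_def J2_def)
  then have fin: "finite J1" "finite J2"
    using assms(4,5) finite_subset by auto
  obtain c1 where c1: "\<And>a. a \<in> A \<Longrightarrow> c1 a \<in> A1 \<and> [a = c1 a] (mod int m1)"
    using A1 by metis
  obtain c2 where c2: "\<And>a. a \<in> A \<Longrightarrow> c2 a \<in> A2 \<and> [a = c2 a] (mod int m2)"
    using A2 by metis
  define S1 S2 where "S1 j = (\<Sum>i\<in>J1. e (Inl i) * f1 i j)" and "S2 j = (\<Sum>i\<in>J2. e (Inr i) * f2 i j)" for j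
  have sum: "(\<Sum>i\<in>J. e i * ?f i j) = int m2 * S1 j + int m1 * S2 j" for j
    unfolding J_eq S1_def S2_def
    by (simp add: sum.Plus fin sum_distrib_left mult.left_commute)
  have S1: "[S1 j = (\<Sum>i\<in>J1. c1 (e (Inl i)) * f1 i j)] (mod int m1)" for j
    unfolding S1_def using c1 e by (intro cong_sum cong_mult) (auto simp: J1_def)
  have S2: "[S2 j = (\<Sum>i\<in>J2. c2 (e (Inr i)) * f2 i j)] (mod int m2)" for j
    unfolding S2_def using c2 e by (intro cong_sum cong_mult) (auto simp: J2_def)
  show "\<exists>j<k. \<not> int (m1 * m2) dvd (\<Sum>i\<in>J. e i * ?f i j)"
  proof (cases "J1 = {}")
    case False
    from free1 sub(1) False obtain j where j: "j < k"
      "\<not> int m1 dvd (\<Sum>i\<in>J1. c1 (e (Inl i)) * f1 i j)"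
      by (rule weighted_zero_freeD[where e = "\<lambda>i. c1 (e (Inl i))"])
        (use c1 e in \<open>auto simp: J1_def\<close>)
    then have "\<not> int m1 dvd S1 j"
      using cong_dvd_iff[OF S1] by blast
    then have "\<not> int m1 dvd int m2 * S1 j + int m1 * S2 j"
      using assms(1) by (simp add: dvd_add_left_iff coprime_dvd_mult_right_iff)
    with j(1) sum show ?thesis
      by (metis dvd_mult_left of_nat_mult)
  next
    case True
    with J(2) J_eq have "J2 \<noteq> {}" by auto
    with free2 sub(2) obtain j where j: "j < k"
      "\<not> int m2 dvd (\<Sum>i\<in>J2. c2 (e (Inr i)) * f2 i j)"
      by (rule weighted_zero_freeD[where e = "\<lambda>i. c2 (e (Inr i))"])
        (use c2 e in \<open>auto simp: J2_def\<close>)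
    then have "\<not> int m2 dvd S2 j"
      using cong_dvd_iff[OF S2] by blast
    then have "\<not> int m2 dvd int m2 * S1 j + int m1 * S2 j"
      using assms(1) by (simp add: dvd_add_right_iff coprime_dvd_mult_right_iff coprime_commute)
    with j(1) sum show ?thesis
      by (metis dvd_mult_right of_nat_mult)
  qed
qed

text \<open>
  The terms that are non-zero in coordinate \<open>j\<close> are those of the \<open>j\<close>-th copy. A zero sum that uses
  the \<open>j\<close>-th copy would therefore give a zero sum over the rank-one family.
\<close>

lemma weighted_zero_free_copies:
  assumes free: "weighted_zero_free m 1 A T (\<lambda>t _. g t)" and "finite T"
  shows "weighted_zero_free m k A ({..<k} \<times> T) (\<lambda>(i, t) j. if i = j then g t else 0)"
    (is "weighted_zero_free _ _ _ _ ?f")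
  unfolding weighted_zero_free_def
proof (intro allI impI)
  fix J e assume J: "J \<subseteq> {..<k} \<times> T" "J \<noteq> {}" and e: "e \<in> J \<rightarrow> A"
  then obtain j t where j: "(j, t) \<in> J" "j < k" by blast
  define K where "K = Pair j -` J"
  have "finite J" using J(1) assms(2) by (auto intro: finite_subset)
  have "K \<subseteq> T" "K \<noteq> {}" "(\<lambda>t. e (j, t)) \<in> K \<rightarrow> A"
    using J j e by (auto simp: K_def)
  from weighted_zero_freeD[OF free this]
  have "\<not> int m dvd (\<Sum>t\<in>K. e (j, t) * g t)" by auto
  moreover have "(\<Sum>p\<in>J. e p * ?f p j) = (\<Sum>t\<in>K. e (j, t) * g t)"
  proof -
    have "(\<Sum>p\<in>J. e p * ?f p j) = (\<Sum>p\<in>Pair j ` K. e p * ?f p j)"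
      using \<open>finite J\<close> by (intro sum.mono_neutral_right) (auto simp: K_def split: if_splits)
    also have "\<dots> = (\<Sum>t\<in>K. e (j, t) * g t)"
      by (subst sum.reindex) (auto simp: inj_on_def)
    finally show ?thesis .
  qed
  ultimately show "\<exists>j<k. \<not> int m dvd (\<Sum>p\<in>J. e p * ?f p j)"
    using j(2) by auto
qed

lemma weighted_davenport_ge_copies:
  assumes "m > 0" "A \<noteq> {}" "finite T" "weighted_zero_free m 1 A T (\<lambda>t _. g t)"
  shows "weighted_davenport A (cyclic_power m k) \<ge> k * card T + 1"
  using weighted_davenport_greater[OF assms(1,2) _ weighted_zero_free_copies[OF assms(4,3), of k]]
    assms(3) by (simp add: card_cartesian_product)

section \<open>Zero-sum free sequences over a cyclic group\<close>

text \<open>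
  The smallest power \<open>2 ^ u\<close> that occurs is the only one not divisible by \<open>2 ^ (u + 1)\<close>, so the signed
  sum is non-zero. Its absolute value is at most \<open>2 ^ r - 1\<close>, which is less than \<open>m\<close>.
\<close>

lemma signed_powers_of_two_free:
  assumes "2 ^ r \<le> m"
  shows "weighted_zero_free m 1 {1, - 1} {..<r} (\<lambda>t _. 2 ^ t)"
proof (rule weighted_zero_free_rank_oneI)
  fix J :: "nat set" and e :: "nat \<Rightarrow> int"
  assume J: "J \<subseteq> {..<r}" "J \<noteq> {}" and e: "e \<in> J \<rightarrow> {1, - 1}"
  let ?S = "\<Sum>t\<in>J. e t * 2 ^ t"
  have sign: "e t = 1 \<or> e t = - 1" if "t \<in> J" for t
    using e that by auto
  have fin: "finite J" using J(1) by (rule finite_subset) simp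
  define u where "u = Min J"
  have u: "u \<in> J" and min: "\<And>t. t \<in> J \<Longrightarrow> u \<le> t"
    using fin J(2) by (auto simp: u_def)
  have "\<not> 2 ^ Suc u dvd ?S"
  proof -
    have "2 ^ Suc u dvd (\<Sum>t\<in>J - {u}. e t * 2 ^ t)"
    proof (intro dvd_sum dvd_mult le_imp_power_dvd)
      fix t assume "t \<in> J - {u}"
      with min[of t] show "Suc u \<le> t" by auto
    qed
    moreover have "\<not> 2 ^ Suc u dvd e u * 2 ^ u"
      using sign[OF u] by auto
    ultimately show ?thesis
      using sum.remove[OF fin u, of "\<lambda>t. e t * 2 ^ t"] by (simp add: dvd_add_left_iff)
  qed
  then have "?S \<noteq> 0" by auto
  moreover have "\<bar>?S\<bar> < int m"
  proof -
    have "\<bar>?S\<bar> \<le> (\<Sum>t\<in>J. \<bar>e t * 2 ^ t\<bar>)" by (rule sum_abs)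
    also have "\<dots> = (\<Sum>t\<in>J. 2 ^ t)"
      by (intro sum.cong) (auto simp: abs_mult dest: sign)
    also have "\<dots> \<le> (\<Sum>t<r. 2 ^ t)"
      using J(1) by (intro sum_mono2) auto
    also have "\<dots> = 2 ^ r - 1"
      by (induction r) auto
    also have "\<dots> < int m"
      using assms by (metis of_nat_le_iff of_nat_numeral of_nat_power zle_diff1_eq diff_less_eq less_add_one order_less_le_trans zless_add1_eq)
    finally show ?thesis .
  qed
  ultimately have "\<not> int m dvd ?S"
    using zdvd_imp_le[of "int m" "\<bar>?S\<bar>"] by auto
  then show "\<not> int m dvd ?S" .
qed

lemma ones_free:
  assumes "m > 0"
  shows "weighted_zero_free m 1 {1} {..<m - 1} (\<lambda>_ _. 1)"
proof (rule weighted_zero_free_rank_oneI)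
  fix J :: "nat set" and e :: "nat \<Rightarrow> int"
  assume J: "J \<subseteq> {..<m - 1}" "J \<noteq> {}" and e: "e \<in> J \<rightarrow> {1}"
  have "0 < card J" "card J < m"
    using J card_mono[OF _ J(1)] assms finite_subset[OF J(1)] by (auto simp: card_gt_0_iff)
  then have "\<not> m dvd card J" by (rule nat_dvd_not_less)
  moreover have "(\<Sum>i\<in>J. e i * 1) = int (card J)"
    using e by (simp add: Pi_iff)
  ultimately show "\<not> int m dvd (\<Sum>i\<in>J. e i * 1)"
    by simp
qed

lemma sum_of_signs_bound_parity:
  assumes "finite J" "c \<in> J \<rightarrow> {1, - 1 :: int}"
  shows "\<bar>sum c J\<bar> \<le> int (card J)" "even (sum c J) \<longleftrightarrow> even (card J)"
  using assms by (induction J) (auto simp: Pi_iff)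

text \<open>
  Modulo \<open>n2\<close> all weights are \<open>1\<close>, so a zero sum has a number of terms divisible by \<open>n2\<close>. Below
  \<open>2 * n2\<close> this leaves only \<open>n2\<close> itself. Modulo \<open>n1\<close> the weights are signs, and an odd number \<open>n2\<close> of
  signs has an odd sum between \<open>-n2\<close> and \<open>n2\<close>. No such number is divisible by an \<open>n1\<close> that is even or
  larger than \<open>n2\<close>.
\<close>

lemma ones_free_odd:
  fixes n1 n2 s :: nat
  assumes "n1 > 0" "n2 > 0" "odd n2" "n1 > n2 \<or> even n1"
    and s1: "[int s = - 1] (mod int n1)" and s2: "[int s = 1] (mod int n2)"
  shows "weighted_zero_free (n1 * n2) 1 {1, int s} {..<2 * n2 - 1} (\<lambda>_ _. 1)"
proof (rule weighted_zero_free_rank_oneI)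
  fix J :: "nat set" and e :: "nat \<Rightarrow> int"
  assume J: "J \<subseteq> {..<2 * n2 - 1}" "J \<noteq> {}" and e: "e \<in> J \<rightarrow> {1, int s}"
  have fin: "finite J" using J(1) by (rule finite_subset) simp
  have e_cases: "e i = 1 \<or> e i = int s" if "i \<in> J" for i
    using e that by auto
  have "\<not> int (n1 * n2) dvd sum e J"
  proof
    assume dvd: "int (n1 * n2) dvd sum e J"
    have "[sum e J = (\<Sum>i\<in>J. 1)] (mod int n2)"
      using e_cases s2 by (intro cong_sum) (metis cong_refl)
    with dvd have "int n2 dvd int (card J)"
      by (metis cong_dvd_iff dvd_mult_right of_nat_mult sum_constant mult.right_neutral of_nat_id)
    then have "n2 dvd card J" by simp
    moreover have "0 < card J" "card J < 2 * n2"
      using J card_mono[OF _ J(1)] assms(2) fin by (auto simp: card_gt_0_iff)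
    ultimately have card: "card J = n2"
      by (auto elim!: dvdE)
    define c where "c i = (if e i = 1 then 1 else - 1 :: int)" for i
    have c: "c \<in> J \<rightarrow> {1, - 1}" by (auto simp: c_def)
    have "[sum e J = sum c J] (mod int n1)"
      using s1 by (intro cong_sum) (auto simp: c_def dest: e_cases)
    with dvd have n1: "int n1 dvd sum c J"
      by (metis cong_dvd_iff dvd_mult_left of_nat_mult)
    have odd: "odd (sum c J)" and le: "\<bar>sum c J\<bar> \<le> int n2"
      using sum_of_signs_bound_parity[OF fin c] card assms(3) by auto
    from assms(4) show False
    proof
      assume "n1 > n2"
      with le n1 zdvd_imp_le[of "int n1" "\<bar>sum c J\<bar>"] have "sum c J = 0" by auto
      with odd show False by simp
    next
      assume "even n1"
      with n1 odd show False
        by (metis dvd_trans even_of_nat)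
    qed
  qed
  then show "\<not> int (n1 * n2) dvd (\<Sum>i\<in>J. e i * 1)"
    by simp
qed

theorem theorem3p1:
  fixes k n n1 n2 s :: nat
  assumes "k \<ge> 1" and "n > 0" and "s > 0"
    and "[(int s)^2 = 1] (mod int n)"
    and "\<not> [int s = 1] (mod int n)" and "\<not> [int s = - 1] (mod int n)"
    and "n = n1 * n2" and "n1 \<ge> 3" and "n2 \<ge> 3" and "coprime n1 n2"
    and "[int s = - 1] (mod int n1)" and "[int s = 1] (mod int n2)"
  shows "(weighted_davenport {1, int s} (cyclic_power n k)
            \<ge> weighted_davenport {1, - 1} (cyclic_power n1 k) + small_davenport (cyclic_power n2 k)
          \<and> int (weighted_davenport {1, - 1} (cyclic_power n1 k) + small_davenport (cyclic_power n2 k))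
            \<ge> int k * (\<lfloor>log 2 (real n1)\<rfloor> + int n2 - 1) + 1)
        \<and> (odd n2 \<and> (n1 > n2 \<or> even n1) \<longrightarrow>
             int (weighted_davenport {1, int s} (cyclic_power n k)) \<ge> int k * (2 * int n2 - 1) + 1)"
proof (intro conjI impI)
  have pos: "n1 > 0" "n2 > 0" using assms(8,9) by auto
  let ?D = "weighted_davenport {1, int s} (cyclic_power n k)"
  let ?D1 = "weighted_davenport {1, - 1} (cyclic_power n1 k)"
  let ?D2 = "weighted_davenport {1} (cyclic_power n2 k)"
  have d2: "small_davenport (cyclic_power n2 k) = ?D2 - 1"
    using Suc_small_davenport_cyclic_power[OF pos(2), of k] by simp
  have D1: "?D1 > 0"
    using weighted_davenport_forces_zero_subseq[OF pos(1)] by simp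
  show "?D \<ge> ?D1 + small_davenport (cyclic_power n2 k)"
  proof -
    obtain f1 where f1: "weighted_zero_free n1 k {1, - 1} {..<?D1 - 1} f1"
      using weighted_davenport_extremal[OF pos(1), of "{1, - 1}"] by auto
    obtain f2 where f2: "weighted_zero_free n2 k {1} {..<?D2 - 1} f2"
      using weighted_davenport_extremal[OF pos(2), of "{1}"] by auto
    have "weighted_zero_free n k {1, int s} ({..<?D1 - 1} <+> {..<?D2 - 1})
        (case_sum (\<lambda>i j. int n2 * f1 i j) (\<lambda>i j. int n1 * f2 i j))"
      unfolding assms(7)
      by (rule weighted_zero_free_coprime_Plus[OF assms(10) f1 f2]) (use assms(11,12) in auto)
    from weighted_davenport_greater[OF assms(2) _ _ this]
    have "card ({..<?D1 - 1} <+> {..<?D2 - 1}) < ?D" by simp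
    then show ?thesis
      using D1 by (simp add: card_Plus d2)
  qed
  show "int (?D1 + small_davenport (cyclic_power n2 k))
      \<ge> int k * (\<lfloor>log 2 (real n1)\<rfloor> + int n2 - 1) + 1"
  proof -
    define r where "r = nat \<lfloor>log 2 (real n1)\<rfloor>"
    have log: "log 2 (real n1) \<ge> 0" using pos by simp
    then have r: "int r = \<lfloor>log 2 (real n1)\<rfloor>" by (simp add: r_def)
    then have "real r \<le> log 2 (real n1)" by linarith
    then have "2 powr real r \<le> real n1" using pos by (simp add: le_log_iff)
    then have "2 ^ r \<le> n1"
      by (simp add: powr_realpow flip: of_nat_le_iff)
    from weighted_davenport_ge_copies[OF pos(1) _ _ signed_powers_of_two_free[OF this], of k]
    have "?D1 \<ge> k * r + 1" by simp
    moreover have "?D2 \<ge> k * (n2 - 1) + 1"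
      using weighted_davenport_ge_copies[OF pos(2) _ _ ones_free[OF pos(2)], of k] by simp
    ultimately have "?D1 + small_davenport (cyclic_power n2 k) \<ge> k * (r + (n2 - 1)) + 1"
      by (simp add: d2 algebra_simps)
    then have "int (?D1 + small_davenport (cyclic_power n2 k)) \<ge> int (k * (r + (n2 - 1)) + 1)"
      by (simp only: of_nat_le_iff)
    with pos r show ?thesis by (simp add: of_nat_diff)
  qed
  show "int ?D \<ge> int k * (2 * int n2 - 1) + 1" if "odd n2 \<and> (n1 > n2 \<or> even n1)"
  proof -
    have "?D \<ge> k * (2 * n2 - 1) + 1"
      using weighted_davenport_ge_copies[OF _ _ _ ones_free_odd[OF pos _ _ assms(11,12)], of k]
        that assms(2,7) by simp
    then have "int ?D \<ge> int (k * (2 * n2 - 1) + 1)"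
      by (simp only: of_nat_le_iff)
    with pos show ?thesis by (simp add: of_nat_diff)
  qed
qed

end
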